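(* Let $\lambda:[0,+\infty)\to[0,+\infty)$ be a strictly monotone increasing continuous function. Let $X$ be an essentially connected geodesic mm-space. If $X$ satisfies $\mathrm{IC}(\nu)$ for a measure $\nu\in\mathcal V_\lambda$, then $\nu$ is a dominant of $X$. In particular, $$\mathrm{ObsVar}_\lambda(X)\le\mathrm{Var}_\lambda(\nu).$$
   Context: An mm-space is a complete separable metric space $(X,d_X)$ with a Borel probability measure $\mu_X$; it is assumed that $X=\operatorname{supp}\mu_X$. It is geodesic if any two points are joined by a minimal geodesic. For a Borel set $A\subset X$, $\mu_X^+(A):=\limsup_{\varepsilon\to0+}\frac{\mu_X(U_\varepsilon(A))-\mu_X(A)}{\varepsilon}$, where $U_\varepsilon(A)$ is the open $\varepsilon$-neighborhood of $A$. $X$ is essentially connected if $\mu_X^+(A)>0$ for any closed set $A\subset X$ with $0<\mu_X(A)<1$. Let $\operatorname{Im}\mu_X$ be the set of values $\mu_X(A)$, $A\subset X$ Borel, and $I_X(v):=\inf\{\mu_X^+(A)\mid A\subset X\text{ Borel},\ \mu_X(A)=v\}$ for $v\in\operatorname{Im}\mu_X$. For a Borel probability measure $\nu$ on $\mathbb R$ with cumulative distribution function $V(t)=\nu((-\infty,t])$, $X$ satisfies $\mathrm{IC}(\nu)$ if $I_X\circ V\ge V'$ holds $\mathcal L^1$-a.e. on $V^{-1}(\operatorname{Im}\mu_X)$, where $\mathcal L^1$ is the Lebesgue measure on $\mathbb R$. A Borel probability measure $\mu$ on $\mathbb R$ dominates another one $\nu$ if there is a $1$-Lipschitz function $h:\mathbb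 R\to\mathbb R$ with $h_*\mu=\nu$. A Borel probability measure on $\mathbb R$ is a dominant of $X$ if it dominates $f_*\mu_X$ for any $1$-Lipschitz function $f:X\to\mathbb R$. $\mathrm{Var}_\lambda(\nu):=\int_{\mathbb R}\int_{\mathbb R}\lambda(|x-x'|)\,d\nu(x)d\nu(x')$. $\mathrm{ObsVar}_\lambda(X)$ is the supremum over all $1$-Lipschitz $f:X\to\mathbb R$ of $\int_X\int_X\lambda(|f(x)-f(x')|)\,d\mu_X(x)d\mu_X(x')$. $\mathcal V_\lambda$ is the set of Borel probability measures $\nu$ on $\mathbb R$ absolutely continuous with respect to $\mathcal L^1$, with connected support, and with $\mathrm{Var}_\lambda(\nu)<+\infty$. *)

theory Defs
  imports "HOL-Probability.Probability"
begin

definition measure_support :: "'a::topological_space measure \<Rightarrow> 'a set" where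
  "measure_support M = {x. \<forall>U. open U \<longrightarrow> x \<in> U \<longrightarrow> emeasure M U > 0}"

text \<open>The underlying space of an mm-space is a type of class \<^class>\<open>polish_space\<close>
  (complete separable metric spaces), so the mm-space is given by its measure.\<close>

definition mm_space :: "'a::polish_space measure \<Rightarrow> bool" where
  "mm_space M \<longleftrightarrow> prob_space M \<and> sets M = sets borel \<and> measure_support M = UNIV"

definition geodesic_space :: "'a::metric_space itself \<Rightarrow> bool" where
  "geodesic_space _ \<longleftrightarrow> (\<forall>x y :: 'a. \<exists>\<gamma> :: real \<Rightarrow> 'a.
     \<gamma> 0 = x \<and> \<gamma> (dist x y) = y \<and>
     (\<forall>s\<in>{0..dist x y}. \<forall>t\<in>{0..dist x y}. dist (\<gamma> s) (\<gamma> t) = \<bar>s - t\<bar>))"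

text \<open>The neighborhood of the empty set is empty. (The library's \<^const>\<open>infdist\<close> is 0 on
  the empty set and would give the whole space instead.)\<close>

definition open_nbhd :: "real \<Rightarrow> 'a::metric_space set \<Rightarrow> 'a set" where
  "open_nbhd \<epsilon> A = (\<Union>a\<in>A. ball a \<epsilon>)"

definition boundary_measure :: "'a::metric_space measure \<Rightarrow> 'a set \<Rightarrow> ereal" where
  "boundary_measure M A =
     Limsup (at_right 0) (\<lambda>\<epsilon>. ereal ((measure M (open_nbhd \<epsilon> A) - measure M A) / \<epsilon>))"

definition essentially_connected :: "'a::metric_space measure \<Rightarrow> bool" where
  "essentially_connected M \<longleftrightarrow>
     (\<forall>A. closed A \<longrightarrow> 0 < measure M A \<longrightarrow> measure M A < 1 \<longrightarrow> 0 < boundary_measure M A)"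

definition measure_values :: "'a::metric_space measure \<Rightarrow> real set" where
  "measure_values M = {measure M A | A. A \<in> sets borel}"

definition isoperimetric_profile :: "'a::metric_space measure \<Rightarrow> real \<Rightarrow> ereal" where
  "isoperimetric_profile M v = Inf {boundary_measure M A | A. A \<in> sets borel \<and> measure M A = v}"

text \<open>The derivative of the (monotone) distribution function exists almost everywhere by
  Lebesgue's theorem, so asking for its existence at almost every point of the relevant set
  does not restrict the condition.\<close>

definition satisfies_IC :: "'a::metric_space measure \<Rightarrow> real measure \<Rightarrow> bool" where
  "satisfies_IC M \<nu> \<longleftrightarrow>
     (AE t in lborel. cdf \<nu> t \<in> measure_values M \<longrightarrow>
        (\<exists>D. (cdf \<nu> has_real_derivative D) (at t) \<and>
             isoperimetric_profile M (cdf \<nu> t) \<ge> ereal D))"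

text \<open>\<^const>\<open>real_distribution\<close> is the predicate ``Borel probability measure on the reals''.\<close>

definition dominates :: "real measure \<Rightarrow> real measure \<Rightarrow> bool" where
  "dominates \<mu> \<nu> \<longleftrightarrow> real_distribution \<mu> \<and> real_distribution \<nu> \<and>
     (\<exists>h. 1-lipschitz_on UNIV h \<and> distr \<mu> borel h = \<nu>)"

definition is_dominant :: "real measure \<Rightarrow> 'a::metric_space measure \<Rightarrow> bool" where
  "is_dominant \<nu> M \<longleftrightarrow> real_distribution \<nu> \<and>
     (\<forall>f :: 'a \<Rightarrow> real. 1-lipschitz_on UNIV f \<longrightarrow> dominates \<nu> (distr M borel f))"

definition Var_lam :: "(real \<Rightarrow> real) \<Rightarrow> real measure \<Rightarrow> ennreal" where
  "Var_lam \<Lambda> \<nu> = (\<integral>\<^sup>+x'. (\<integral>\<^sup>+x. ennreal (\<Lambda> \<bar>x - x'\<bar>) \<partial>\<nu>) \<partial>\<nu>)"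

definition ObsVar :: "(real \<Rightarrow> real) \<Rightarrow> 'a::metric_space measure \<Rightarrow> ennreal" where
  "ObsVar \<Lambda> M = (SUP f\<in>{f :: 'a \<Rightarrow> real. 1-lipschitz_on UNIV f}.
     (\<integral>\<^sup>+x'. (\<integral>\<^sup>+x. ennreal (\<Lambda> \<bar>f x - f x'\<bar>) \<partial>M) \<partial>M))"

definition Var_class :: "(real \<Rightarrow> real) \<Rightarrow> real measure set" where
  "Var_class \<Lambda> = {\<nu>. real_distribution \<nu> \<and> absolutely_continuous lborel \<nu> \<and>
     connected (measure_support \<nu>) \<and> Var_lam \<Lambda> \<nu> < \<infinity>}"

end

theory Submission
  imports Defs
begin

text \<open>
  Let \<open>f\<close> be a 1-Lipschitz observable, \<open>F\<close> the distribution function of its law and \<open>V\<close> that of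
  \<open>\<nu>\<close>. The increasing rearrangement \<open>q t = Inf {x. V t \<le> F x}\<close> transports \<open>\<nu>\<close> to the law of \<open>f\<close>,
  so domination amounts to \<open>q\<close> being 1-Lipschitz where \<open>0 < V < 1\<close>: it then extends to the line.

  The isoperimetric comparison is a bound on the slope of \<open>q\<close>. The \<open>\<epsilon>\<close>-neighbourhood of a sublevel
  set \<open>{f \<le> s}\<close> lies in \<open>{f \<le> s + \<epsilon>}\<close>, so the boundary measure of \<open>{f \<le> s}\<close> is at most the
  upper right derivative of \<open>F\<close> at \<open>s\<close> (\<open>boundary_measure_sublevel_le\<close>). If \<open>s = q t\<close> and
  \<open>F s = V t\<close>, the comparison therefore says that this derivative is at least \<open>V' t\<close>, and since
  \<open>V\<close> and \<open>F \<circ> q\<close> agree there, \<open>q\<close> has arbitrarily short steps to the right of slope at most any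
  \<open>K > 1\<close> (\<open>right_step_at_derivative\<close>). At a jump of \<open>F\<close>, where \<open>V t < F (q t)\<close>, the map \<open>q\<close> is
  locally constant to the right.

  This works for almost every \<open>t\<close> only, and a monotone function may rise on a null set. Here
  essential connectedness helps: the upper right derivative of \<open>F\<close> is positive at
  \<^emph>\<open>every\<close> \<open>s\<close> with \<open>0 < F s < 1\<close>, so even at an exceptional \<open>t\<close> some short step to the right
  satisfies \<open>q u - q t \<le> k * \<nu> {t<..u}\<close> for some \<open>k\<close> depending on \<open>t\<close>. The exceptional set is
  \<open>\<nu>\<close>-null, because \<open>\<nu>\<close> is absolutely continuous, and can be enclosed in open sets of so small
  measure that all these steps together contribute at most any given \<open>\<eta> > 0\<close>
  (\<open>diff_le_if_right_steps_off_null_set\<close>). A supremum argument, which chains short steps across an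
  interval, then gives \<open>q b - q a \<le> K * (b - a)\<close> for all \<open>K > 1\<close>.

  The bound for the observable variance follows because a 1-Lipschitz map shrinks distances and
  \<open>\<Lambda>\<close> is increasing.
\<close>

section \<open>Increments of functions controlled at every point\<close>

text \<open>The set of all \<open>t\<close> for which the bound holds between \<open>a\<close> and \<open>t\<close> contains its supremum, by
  semicontinuity of \<open>h\<close> from the left and monotonicity of \<open>\<phi>\<close>, and by the step hypothesis the
  supremum cannot lie before \<open>b\<close>. One step from each point is enough.\<close>

lemma diff_le_if_right_steps:
  fixes h \<phi> :: "real \<Rightarrow> real"
  assumes "a \<le> b" and mono: "mono_on {a..b} \<phi>"
    and lsc: "\<And>c y. a < c \<Longrightarrow> c \<le> b \<Longrightarrow> y < h c \<Longrightarrow> eventually (\<lambda>t. y < h t) (at_left c)"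
    and step: "\<And>t. a \<le> t \<Longrightarrow> t < b \<Longrightarrow> \<exists>u. t < u \<and> u \<le> b \<and> h u - h t \<le> \<phi> u - \<phi> t"
  shows "h b - h a \<le> \<phi> b - \<phi> a"
proof -
  define S where "S = {t\<in>{a..b}. h t - \<phi> t \<le> h a - \<phi> a}"
  have aS: "a \<in> S" using \<open>a \<le> b\<close> by (simp add: S_def)
  have bdd: "bdd_above S" by (auto simp: S_def intro!: bdd_aboveI[of _ b])
  define c where "c = Sup S"
  have upper: "t \<le> c" if "t \<in> S" for t
    using that bdd unfolding c_def by (rule cSup_upper)
  have ac: "a \<le> c" using upper aS by simp
  have cb: "c \<le> b" unfolding c_def using aS by (intro cSup_least) (auto simp: S_def)
  have cS: "c \<in> S"
  proof (rule ccontr)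
    assume "c \<notin> S"
    hence "a < c" using ac aS by (cases "a = c") auto
    define y where "y = h a - \<phi> a + \<phi> c"
    have "y < h c" using \<open>c \<notin> S\<close> ac cb by (auto simp: S_def y_def)
    from lsc[OF \<open>a < c\<close> cb this] obtain d where d: "d < c" "\<And>t. d < t \<Longrightarrow> t < c \<Longrightarrow> y < h t"
      by (auto simp: eventually_at_left[OF \<open>a < c\<close>])
    obtain t where t: "t \<in> S" "d < t"
      using less_cSup_iff[of S d] aS bdd d(1) by (auto simp: c_def)
    have "t < c" using upper[OF t(1)] t(1) \<open>c \<notin> S\<close> by (cases "t = c") auto
    hence "y < h t" using d t by auto
    moreover have "\<phi> t \<le> \<phi> c" using t \<open>t < c\<close> cb ac
      by (intro mono_onD[OF mono]) (auto simp: S_def)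
    ultimately show False using t(1) by (auto simp: S_def y_def)
  qed
  have "c = b"
  proof (rule ccontr)
    assume "c \<noteq> b"
    with step[of c] ac cb obtain u where "c < u" "u \<le> b" "h u - h c \<le> \<phi> u - \<phi> c" by auto
    hence "u \<in> S" using cS by (auto simp: S_def)
    thus False using upper \<open>c < u\<close> by force
  qed
  thus ?thesis using cS by (simp add: S_def)
qed

lemma (in real_distribution) open_superset_of_null_set:
  assumes "N \<in> null_sets M" "0 < e"
  obtains U where "open U" "N \<subseteq> U" "measure M U < e"
proof -
  have "(INF U \<in> {U. N \<subseteq> U \<and> open U}. emeasure M U) = 0"
    using outer_regular[of M N] null_setsD1[OF assms(1)] null_setsD2[OF assms(1)]
    by (simp add: emeasure_eq_measure)
  hence "(INF U \<in> {U. N \<subseteq> U \<and> open U}. emeasure M U) < ennreal e" using assms by simp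
  then obtain U where "N \<subseteq> U" "open U" "emeasure M U < ennreal e"
    unfolding INF_less_iff by auto
  thus thesis using assms by (intro that) (auto simp: emeasure_eq_measure ennreal_less_iff)
qed

text \<open>On the null set \<open>N\<close> the steps are bounded by measure instead of length, with a factor \<open>k\<close>
  that is not uniform. For each \<open>k\<close>, choose an open \<open>U k \<supseteq> N\<close> so small that
  \<open>(\<Sum>k. k * measure M (U k)) \<le> \<eta>\<close>. Then \<open>K * t + (\<Sum>k. k * measure M (U k \<inter> {..t}))\<close> majorizes
  the steps of \<open>h\<close> at every point, and its total increment exceeds \<open>K * (b - a)\<close> by at most
  \<open>\<eta>\<close>.\<close>

lemma (in real_distribution) diff_le_if_right_steps_off_null_set:
  fixes h :: "real \<Rightarrow> real"
  assumes "a \<le> b" "0 \<le> K" and N: "N \<in> null_sets M"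
    and lsc: "\<And>c y. a < c \<Longrightarrow> c \<le> b \<Longrightarrow> y < h c \<Longrightarrow> eventually (\<lambda>t. y < h t) (at_left c)"
    and step: "\<And>t. a \<le> t \<Longrightarrow> t < b \<Longrightarrow> t \<notin> N \<Longrightarrow>
        \<exists>u. t < u \<and> u \<le> b \<and> h u - h t \<le> K * (u - t)"
    and step_N: "\<And>t. a \<le> t \<Longrightarrow> t < b \<Longrightarrow> t \<in> N \<Longrightarrow>
        \<exists>k::nat. \<forall>r>0. \<exists>u. t < u \<and> u < t + r \<and> u \<le> b \<and> h u - h t \<le> real k * (cdf M u - cdf M t)"
  shows "h b - h a \<le> K * (b - a)"
proof (rule field_le_epsilon)
  fix \<eta> :: real assume "0 < \<eta>"
  have "\<exists>U. open U \<and> N \<subseteq> U \<and> measure M U < \<eta> * (1/2) ^ Suc k / (real k + 1)" for k :: nat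
    using open_superset_of_null_set[OF N, of "\<eta> * (1/2) ^ Suc k / (real k + 1)"] \<open>0 < \<eta>\<close>
    by (metis add.commute divide_pos_pos half_gt_zero_iff mult_pos_pos of_nat_Suc of_nat_0_less_iff
        zero_less_Suc zero_less_numeral zero_less_one zero_less_power)
  then obtain U where U: "\<And>k. open (U k)" "\<And>k. N \<subseteq> U k"
      "\<And>k::nat. measure M (U k) < \<eta> * (1/2) ^ Suc k / (real k + 1)"
    by metis
  have Um [measurable]: "U k \<in> sets borel" for k using U(1) by (rule borel_open)
  have small: "real k * measure M (U k \<inter> A) \<le> \<eta> * (1/2) ^ Suc k" for k A
  proof (cases "U k \<inter> A \<in> sets M")
    case True
    have "measure M (U k \<inter> A) \<le> measure M (U k)" by (intro finite_measure_mono) (auto simp: Um)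
    hence "real k * measure M (U k \<inter> A) \<le> (real k + 1) * measure M (U k)"
      by (intro mult_mono) auto
    also have "\<dots> \<le> \<eta> * (1/2) ^ Suc k" using U(3)[of k] by (simp add: less_divide_eq algebra_simps)
    finally show ?thesis .
  qed (use \<open>0 < \<eta>\<close> in \<open>simp add: measure_notin_sets\<close>)
  have sums: "(\<lambda>k. \<eta> * (1/2) ^ Suc k) sums \<eta>"
    using sums_mult[OF power_half_series, of \<eta>] by simp
  have summ: "summable (\<lambda>k. real k * measure M (U k \<inter> A))" for A
    by (rule summable_comparison_test'[OF sums_summable[OF sums], of 0]) (use small in auto)
  define S where "S A = (\<Sum>k. real k * measure M (U k \<inter> A))" for A
  have S_le: "S A \<le> \<eta>" for A
    using suminf_le[OF small summ sums_summable[OF sums], of A] sums_unique[OF sums]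
    by (simp add: S_def)
  have S_nonneg: "0 \<le> S A" for A unfolding S_def by (rule suminf_nonneg[OF summ]) auto
  have S_diff: "S {..u} - S {..t} = S {t<..u}" if "t \<le> u" for t u
  proof -
    have "measure M (U k \<inter> {..u}) = measure M (U k \<inter> {..t}) + measure M (U k \<inter> {t<..u})" for k
      using that by (subst finite_measure_Union[symmetric]) (auto intro!: arg_cong[of _ _ "measure M"])
    thus ?thesis unfolding S_def
      by (subst suminf_diff[OF summ summ]) (simp add: algebra_simps)
  qed
  define \<phi> where "\<phi> t = K * t + S {..t}" for t
  have \<phi>_diff: "\<phi> u - \<phi> t = K * (u - t) + S {t<..u}" if "t \<le> u" for t u
    using S_diff[OF that] by (simp add: \<phi>_def algebra_simps)
  have "h b - h a \<le> \<phi> b - \<phi> a"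
  proof (rule diff_le_if_right_steps[OF \<open>a \<le> b\<close> _ lsc])
    show "mono_on {a..b} \<phi>"
    proof (rule mono_onI)
      fix t u :: real assume "t \<le> u"
      thus "\<phi> t \<le> \<phi> u" using \<phi>_diff[of t u] S_nonneg[of "{t<..u}"] \<open>0 \<le> K\<close>
        by (smt (verit) mult_nonneg_nonneg)
    qed
    fix t assume t: "a \<le> t" "t < b"
    show "\<exists>u. t < u \<and> u \<le> b \<and> h u - h t \<le> \<phi> u - \<phi> t"
    proof (cases "t \<in> N")
      case False
      from step[OF t this] show ?thesis using \<phi>_diff S_nonneg by (smt (verit))
    next
      case True
      from step_N[OF t this] obtain k :: nat where k: "\<And>r. r > 0 \<Longrightarrow>
          \<exists>u. t < u \<and> u < t + r \<and> u \<le> b \<and> h u - h t \<le> real k * (cdf M u - cdf M t)" by blast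
      have "t \<in> U k" using U(2) True by auto
      then obtain r where r: "r > 0" "ball t r \<subseteq> U k" using U(1) openE by blast
      from k[OF r(1)] obtain u where u: "t < u" "u < t + r" "u \<le> b"
        "h u - h t \<le> real k * (cdf M u - cdf M t)" by blast
      \<comment> \<open>A step that stays inside \<open>U k\<close> is paid for in full by the \<open>k\<close>-th term of the series.\<close>
      have "U k \<inter> {t<..u} = {t<..u}" using r(2) u by (auto simp: dist_real_def subset_iff)
      hence "real k * (cdf M u - cdf M t) = real k * measure M (U k \<inter> {t<..u})"
        using cdf_diff_eq[OF u(1)] by simp
      also have "\<dots> \<le> S {t<..u}"
        unfolding S_def using sum_le_suminf[OF summ, of "{k}"] by simp
      also have "\<dots> \<le> \<phi> u - \<phi> t" using \<phi>_diff[of t u] u(1) \<open>0 \<le> K\<close> by simp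
      finally show ?thesis using u by force
    qed
  qed
  also have "\<dots> \<le> K * (b - a) + \<eta>" using \<phi>_diff[OF \<open>a \<le> b\<close>] S_le by simp
  finally show "h b - h a \<le> K * (b - a) + \<eta>" .
qed

section \<open>Extension of real-valued Lipschitz functions\<close>

text \<open>McShane's extension: the infimum of the largest \<open>L\<close>-Lipschitz functions that take the value
  \<open>f s\<close> at one point \<open>s \<in> S\<close>.\<close>

lemma lipschitz_extension:
  fixes f :: "'a::metric_space \<Rightarrow> real"
  assumes f: "L-lipschitz_on S f"
  obtains g where "L-lipschitz_on UNIV g" "\<And>x. x \<in> S \<Longrightarrow> g x = f x"
proof (cases "S = {}")
  case True
  thus ?thesis using that[of "\<lambda>_. 0"] lipschitz_on_nonneg[OF f] by (auto simp: lipschitz_on_def)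
next
  case False
  have L: "0 \<le> L" by (rule lipschitz_on_nonneg[OF f])
  have lip: "f s \<le> f t + L * dist s t" if "s \<in> S" "t \<in> S" for s t
    using lipschitz_onD[OF f that] by (auto simp: dist_real_def)
  have tri: "f t \<le> f s + L * dist x s + L * dist x t" if "s \<in> S" "t \<in> S" for s t x
  proof -
    have "L * dist t s \<le> L * (dist x s + dist x t)"
      using L by (intro mult_left_mono) (metis add.commute dist_commute dist_triangle, simp)
    thus ?thesis using lip[OF that(2,1)] by (simp add: distrib_left)
  qed
  have bdd: "bdd_below ((\<lambda>s. f s + L * dist x s) ` S)" for x
  proof -
    obtain t where "t \<in> S" using False by auto
    thus ?thesis using tri[of _ t x] by (intro bdd_belowI2[of _ "f t - L * dist x t"]) force
  qed
  define g where "g x = (INF s\<in>S. f s + L * dist x s)" for x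
  have le: "g x \<le> g y + L * dist x y" for x y
  proof -
    have "g x - L * dist x y \<le> g y"
      unfolding g_def[of y]
    proof (rule cINF_greatest[OF False])
      fix s assume s: "s \<in> S"
      have "g x \<le> f s + L * dist x s" unfolding g_def by (rule cINF_lower[OF bdd s])
      also have "L * dist x s \<le> L * (dist x y + dist y s)"
        using L by (intro mult_left_mono) (auto intro: dist_triangle)
      finally show "g x - L * dist x y \<le> f s + L * dist y s" by (simp add: distrib_left)
    qed
    thus ?thesis by simp
  qed
  show ?thesis
  proof (rule that)
    show "L-lipschitz_on UNIV g"
      using le L by (intro lipschitz_onI) (auto simp: dist_real_def abs_le_iff dist_commute algebra_simps,
         metis add.commute dist_commute)
    fix x assume x: "x \<in> S"
    show "g x = f x"
    proof (rule antisym)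
      show "g x \<le> f x" using cINF_lower[OF bdd x, of x] by (simp add: g_def)
      show "f x \<le> g x" unfolding g_def
        by (rule cINF_greatest[OF False]) (use lip x in auto)
    qed
  qed
qed

section \<open>The monotone transport between distributions on the line\<close>

definition upper_right_derivative :: "(real \<Rightarrow> real) \<Rightarrow> real \<Rightarrow> ereal" where
  "upper_right_derivative F s = Limsup (at_right 0) (\<lambda>\<epsilon>. ereal ((F (s + \<epsilon>) - F s) / \<epsilon>))"

lemma less_upper_right_derivativeD:
  assumes "ereal c < upper_right_derivative F s" "0 < r"
  obtains \<epsilon> where "0 < \<epsilon>" "\<epsilon> < r" "c * \<epsilon> < F (s + \<epsilon>) - F s"
proof (rule ccontr)
  assume *: "\<not> thesis"
  have "F (s + \<epsilon>) - F s \<le> c * \<epsilon>" if "0 < \<epsilon>" "\<epsilon> < r" for \<epsilon>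
    using * that(1,2) \<open>\<And>\<epsilon>. 0 < \<epsilon> \<Longrightarrow> \<epsilon> < r \<Longrightarrow> c * \<epsilon> < F (s + \<epsilon>) - F s \<Longrightarrow> thesis\<close> not_less by blast
  hence "eventually (\<lambda>\<epsilon>. ereal ((F (s + \<epsilon>) - F s) / \<epsilon>) \<le> ereal c) (at_right 0)"
    using assms(2) by (intro eventually_at_rightI[of 0 r]) (auto simp: divide_le_eq)
  from Limsup_bounded[OF this] show False
    using assms(1) by (simp add: upper_right_derivative_def not_less[symmetric])
qed

text \<open>\<open>\<nu>\<close> is to be transported to \<open>\<mu>\<close>. The two growth assumptions are what is left of essential
  connectedness and of the isoperimetric comparison when they are applied to sublevel sets of an
  observable with law \<open>\<mu>\<close>: positivity holds at every interior level, the comparison of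
  derivatives almost everywhere only. The law \<open>\<mu>\<close> may have atoms.\<close>

locale quantile_transport =
  source: real_distribution \<nu> + target: cdf_distribution \<mu> for \<nu> \<mu> :: "real measure" +
  assumes cont: "\<And>t. isCont (cdf \<nu>) t"
    and strict: "\<And>s t. s < t \<Longrightarrow> 0 < cdf \<nu> s \<Longrightarrow> cdf \<nu> s < 1 \<Longrightarrow> cdf \<nu> s < cdf \<nu> t"
    and growth_pos: "\<And>s. 0 < cdf \<mu> s \<Longrightarrow> cdf \<mu> s < 1 \<Longrightarrow> 0 < upper_right_derivative (cdf \<mu>) s"
    and growth_AE: "AE t in \<nu>. \<forall>s. 0 < cdf \<nu> t \<longrightarrow> cdf \<nu> t < 1 \<longrightarrow> cdf \<mu> s = cdf \<nu> t \<longrightarrow>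
        (\<exists>D. (cdf \<nu> has_real_derivative D) (at t) \<and> ereal D \<le> upper_right_derivative (cdf \<mu>) s)"
begin

abbreviation V where "V \<equiv> cdf \<nu>"
abbreviation F where "F \<equiv> cdf \<mu>"

definition q :: "real \<Rightarrow> real" where "q t = Inf {x. V t \<le> F x}"

definition T :: "real set" where "T = {t. 0 < V t \<and> V t < 1}"

lemma V_mono: "s \<le> t \<Longrightarrow> V s \<le> V t"
  by (rule source.cdf_nondecreasing)

lemma T_ivl: "a \<in> T \<Longrightarrow> b \<in> T \<Longrightarrow> a \<le> t \<Longrightarrow> t \<le> b \<Longrightarrow> t \<in> T"
  using V_mono[of a t] V_mono[of t b] by (auto simp: T_def)

lemma V_IVT:
  assumes "0 < v" "v < 1" obtains t where "V t = v"
proof -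
  obtain a where a: "V a < v"
    using order_tendstoD(2)[OF source.cdf_lim_at_bot \<open>0 < v\<close>]
      eventually_happens'[OF trivial_limit_at_bot_linorder] by blast
  obtain b where b: "v < V b"
    using order_tendstoD(1)[OF source.cdf_lim_at_top_prob \<open>v < 1\<close>]
      eventually_happens'[OF trivial_limit_at_top_linorder] by blast
  have "a \<le> b" using a b V_mono[of b a] by linarith
  with a b show ?thesis using IVT[of V a v b] cont that by auto
qed

lemma q_le_iff: "t \<in> T \<Longrightarrow> q t \<le> x \<longleftrightarrow> V t \<le> F x"
  unfolding q_def T_def using target.pseudoinverse[of "V t" x] by auto

text \<open>As a generalized inverse, \<open>q\<close> is lower semicontinuous from the left by \<open>q_le_iff\<close>:
  \<open>y < q t\<close> means \<open>F y < V t\<close>, and this is an open condition because \<open>V\<close> is continuous.\<close>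

lemma q_lsc:
  assumes "c \<in> T" "y < q c"
  shows "eventually (\<lambda>t. y < q t) (at_left c)"
proof -
  have tend: "(V \<longlongrightarrow> V c) (at_left c)"
    using cont[of c] unfolding isCont_def by (rule tendsto_within_subset) auto
  have "F y < V c" using assms q_le_iff[of c y] by auto
  hence "eventually (\<lambda>t. F y < V t) (at_left c)" by (rule order_tendstoD(1)[OF tend])
  moreover have "eventually (\<lambda>t. 0 < V t) (at_left c)"
    using order_tendstoD(1)[OF tend] assms by (auto simp: T_def)
  moreover have "eventually (\<lambda>t. V t < 1) (at_left c)"
    using order_tendstoD(2)[OF tend] assms by (auto simp: T_def)
  ultimately show ?thesis
  proof eventually_elim
    case (elim t)
    thus ?case using q_le_iff[of t y] by (auto simp: T_def)
  qed
qed

text \<open>Levels strictly inside a jump of \<open>F\<close> are all sent to the place of the jump.\<close>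

lemma right_step_at_jump:
  assumes "t \<in> T" "V t < F (q t)" "t < b"
  shows "\<exists>u. t < u \<and> u < b \<and> q u \<le> q t"
proof -
  have "eventually (\<lambda>u. V u < min 1 (F (q t))) (at_right t)"
  proof (rule order_tendstoD(2))
    show "(V \<longlongrightarrow> V t) (at_right t)"
      using cont[of t] unfolding isCont_def by (rule tendsto_within_subset) auto
  qed (use assms in \<open>auto simp: T_def\<close>)
  then obtain d where d: "t < d" "\<And>u. t < u \<Longrightarrow> u < d \<Longrightarrow> V u < min 1 (F (q t))"
    by (auto simp: eventually_at_right[OF \<open>t < b\<close>])
  obtain u where u: "t < u" "u < min b d" using dense[of t "min b d"] assms d by auto
  have "V u < min 1 (F (q t))" using d u by auto
  hence "u \<in> T" "V u \<le> F (q t)" using V_mono[of t u] u assms(1) by (auto simp: T_def)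
  thus ?thesis using u q_le_iff[of u "q t"] by auto
qed

text \<open>Choose \<open>\<epsilon>\<close> with \<open>c * \<epsilon> < F (q t + \<epsilon>) - F (q t)\<close> and let \<open>u\<close> be a point where \<open>V\<close> takes the
  value \<open>F (q t + \<epsilon>)\<close>; then \<open>q u \<le> q t + \<epsilon>\<close>. The point \<open>u\<close> is close to \<open>t\<close> for small \<open>\<epsilon>\<close>
  because \<open>V\<close> is strictly increasing and \<open>F\<close> continuous from the right.\<close>

lemma right_step_at_growth:
  assumes t: "t \<in> T" and "F (q t) = V t" and c: "0 < c" "ereal c < upper_right_derivative F (q t)"
    and "t < b"
  shows "\<exists>u. t < u \<and> u < b \<and> c * (q u - q t) < V u - V t"
proof -
  have "F (q t) < V b" using strict[of t b] assms by (auto simp: T_def)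
  hence "eventually (\<lambda>x. F x < V b) (at_right (q t))"
    using target.cdf_is_right_cont[of "q t"] unfolding continuous_within
    by (intro order_tendstoD(2)[of F "F (q t)"])
  then obtain d where d: "q t < d" "\<And>x. q t < x \<Longrightarrow> x < d \<Longrightarrow> F x < V b"
    by (auto simp: eventually_at_right_field)
  obtain \<epsilon> where e: "0 < \<epsilon>" "\<epsilon> < d - q t" "c * \<epsilon> < F (q t + \<epsilon>) - F (q t)"
    using less_upper_right_derivativeD[OF c(2), of "d - q t"] d(1) by auto
  have lt: "F (q t + \<epsilon>) < V b" using d e by auto
  have gt: "V t < F (q t + \<epsilon>)" using e(3) mult_pos_pos[OF c(1) e(1)] assms(2) by linarith
  obtain u where u: "t \<le> u" "u \<le> b" "V u = F (q t + \<epsilon>)"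
    using IVT[of V t "F (q t + \<epsilon>)" b] lt gt cont \<open>t < b\<close> by auto
  have "t < u" "u < b" using u gt lt by (auto simp: less_le)
  moreover have "u \<in> T" using t u gt lt source.cdf_bounded_prob[of b] by (auto simp: T_def)
  hence "q u - q t \<le> \<epsilon>" using q_le_iff[of u "q t + \<epsilon>"] u by simp
  hence "c * (q u - q t) \<le> c * \<epsilon>" using c(1) by simp
  hence "c * (q u - q t) < V u - V t" using e(3) u(3) assms(2) by linarith
  ultimately show ?thesis by blast
qed

text \<open>Any \<open>c > 0\<close> strictly below the upper right derivative of \<open>F\<close> with \<open>D < c * K\<close> will do: for
  \<open>u\<close> near \<open>t\<close>, the increment of \<open>V\<close> is below \<open>c * K * (u - t)\<close> and, on suitable steps, above
  \<open>c * (q u - q t)\<close>. If \<open>D > 0\<close> such a \<open>c\<close> exists just below \<open>D\<close>; if \<open>D \<le> 0\<close>, any small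
  positive \<open>c\<close> qualifies, by the positivity of growth.\<close>

lemma right_step_at_derivative:
  assumes t: "t \<in> T" and eq: "F (q t) = V t" and D: "(V has_real_derivative D) (at t)"
    and DF: "ereal D \<le> upper_right_derivative F (q t)" and K: "1 < K" and "t < b"
  shows "\<exists>u. t < u \<and> u < b \<and> q u - q t \<le> K * (u - t)"
proof -
  have pos: "0 < upper_right_derivative F (q t)"
    using growth_pos[of "q t"] t eq by (auto simp: T_def)
  obtain c where c: "0 < c" "D < c * K" "ereal c < upper_right_derivative F (q t)"
  proof (cases "0 < D")
    case True
    have "D / K < D" using True K by (simp add: field_simps)
    then obtain c where "D / K < c" "c < D" using dense by blast
    moreover from this have "0 < c" using True K by (meson divide_pos_pos less_trans zero_less_one)
    ultimately show ?thesis using K DF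
      by (intro that[of c]) (auto simp: field_simps intro: less_le_trans[of _ "ereal D"])
  next
    case False
    obtain c where "0 < c" "ereal c < upper_right_derivative F (q t)"
      using ereal_dense2[OF pos] by auto
    thus ?thesis using False K by (intro that[of c]) (auto intro: le_less_trans[of D 0])
  qed
  have "((\<lambda>u. (V u - V t) / (u - t)) \<longlongrightarrow> D) (at_right t)"
    using D unfolding has_field_derivative_iff by (rule tendsto_within_subset) auto
  hence "eventually (\<lambda>u. (V u - V t) / (u - t) < c * K) (at_right t)"
    using c(2) by (rule order_tendstoD)
  then obtain d where d: "t < d" "\<And>u. t < u \<Longrightarrow> u < d \<Longrightarrow> (V u - V t) / (u - t) < c * K"
    by (auto simp: eventually_at_right[OF \<open>t < b\<close>])
  obtain u where u: "t < u" "u < min b d" "c * (q u - q t) < V u - V t"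
    using right_step_at_growth[OF t eq c(1,3), of "min b d"] d \<open>t < b\<close> by auto
  have "V u - V t < c * K * (u - t)" using d(2)[of u] u by (simp add: field_simps)
  hence "c * (q u - q t) < c * (K * (u - t))" using u(3) by (simp add: mult.assoc)
  hence "q u - q t < K * (u - t)" using c(1) by simp
  thus ?thesis using u by force
qed

lemma q_diff_le:
  assumes ab: "a \<in> T" "b \<in> T" "a \<le> b"
  shows "q b - q a \<le> b - a"
proof (rule field_le_epsilon)
  fix e :: real assume "0 < e"
  define K where "K = 1 + e / (b - a + 1)"
  have K: "1 < K" and Kle: "K * (b - a) \<le> b - a + e"
    using \<open>0 < e\<close> ab(3) by (auto simp: K_def field_simps intro!: add_nonneg_pos divide_pos_pos)
  from growth_AE obtain N where N_null: "N \<in> null_sets \<nu>"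
    and N: "{t. \<not> (\<forall>s. 0 < V t \<longrightarrow> V t < 1 \<longrightarrow> F s = V t \<longrightarrow>
        (\<exists>D. (V has_real_derivative D) (at t) \<and> ereal D \<le> upper_right_derivative F s))} \<subseteq> N"
    by (auto simp: eventually_ae_filter)
  have "q b - q a \<le> K * (b - a)"
  proof (rule source.diff_le_if_right_steps_off_null_set[OF ab(3) _ N_null])
    show "0 \<le> K" using K by simp
    show "eventually (\<lambda>t. y < q t) (at_left c)" if "a < c" "c \<le> b" "y < q c" for c y
      using that q_lsc[of c y] T_ivl[OF ab(1,2), of c] by auto
  next
    fix t assume t: "a \<le> t" "t < b" "t \<notin> N"
    hence tT: "t \<in> T" using T_ivl[OF ab(1,2)] by auto
    show "\<exists>u. t < u \<and> u \<le> b \<and> q u - q t \<le> K * (u - t)"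
    proof (cases "F (q t) = V t")
      case True
      from N t(3) tT True obtain D where "(V has_real_derivative D) (at t)"
        "ereal D \<le> upper_right_derivative F (q t)"
        unfolding T_def by blast
      from right_step_at_derivative[OF tT True this K t(2)] show ?thesis by force
    next
      case False
      hence "V t < F (q t)" using q_le_iff[OF tT, of "q t"] by simp
      from right_step_at_jump[OF tT this t(2)] obtain u where u: "t < u" "u < b" "q u \<le> q t" by blast
      have "0 \<le> K * (u - t)" using K u by simp
      thus ?thesis using u by (intro exI[of _ u]) auto
    qed
  next
    fix t assume t: "a \<le> t" "t < b" "t \<in> N"
    hence tT: "t \<in> T" using T_ivl[OF ab(1,2)] by auto
    show "\<exists>k::nat. \<forall>r>0. \<exists>u. t < u \<and> u < t + r \<and> u \<le> b \<and> q u - q t \<le> real k * (V u - V t)"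
    proof (cases "F (q t) = V t")
      case True
      have "0 < upper_right_derivative F (q t)"
        using growth_pos[of "q t"] tT True by (auto simp: T_def)
      then obtain c where c: "0 < c" "ereal c < upper_right_derivative F (q t)"
        using ereal_dense2 by (metis ereal_less(2))
      obtain k :: nat where k: "1 / c \<le> real k" using real_arch_simple by blast
      show ?thesis
      proof (intro exI[of _ k] allI impI)
        fix r :: real assume "0 < r"
        then obtain u where u: "t < u" "u < min b (t + r)" "c * (q u - q t) < V u - V t"
          using right_step_at_growth[OF tT True c, of "min b (t + r)"] t by auto
        have "q u - q t \<le> (1 / c) * (V u - V t)" using u(3) c(1) by (simp add: field_simps)
        also have "\<dots> \<le> real k * (V u - V t)"
          using k V_mono[of t u] u(1) by (intro mult_right_mono) auto
        finally show "\<exists>u. t < u \<and> u < t + r \<and> u \<le> b \<and> q u - q t \<le> real k * (V u - V t)"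
          using u by (intro exI[of _ u]) auto
      qed
    next
      case False
      hence "V t < F (q t)" using q_le_iff[OF tT, of "q t"] by simp
      from right_step_at_jump[OF tT this, of "min b (t + r)" for r] t(2) show ?thesis
        by (intro exI[of _ 0]) force
    qed
  qed
  thus "q b - q a \<le> b - a + e" using Kle by simp
qed

lemma q_lipschitz: "1-lipschitz_on T q"
proof (rule lipschitz_onI)
  fix s t assume st: "s \<in> T" "t \<in> T"
  have mono: "q s \<le> q t" if "s \<in> T" "t \<in> T" "s \<le> t" for s t
    using q_le_iff[OF that(1)] q_le_iff[OF that(2), of "q t"] V_mono[OF that(3)] by auto
  show "dist (q s) (q t) \<le> 1 * dist s t"
    using mono[OF st] mono[OF st(2,1)] q_diff_le[OF st] q_diff_le[OF st(2,1)]
    by (cases "s \<le> t") (auto simp: dist_real_def)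
qed simp

text \<open>The level \<open>v\<close> is attained exactly once, so \<open>{V \<le> v}\<close> is the half-line ending there; in other
  words, \<open>V\<close> is uniformly distributed under \<open>\<nu>\<close>.\<close>

lemma measure_V_le:
  assumes "0 < v" "v < 1"
  shows "measure \<nu> {t. V t \<le> v} = v"
proof -
  obtain t0 where t0: "V t0 = v" using V_IVT[OF assms] .
  have "V t \<le> v \<longleftrightarrow> t \<le> t0" for t
  proof (cases "t \<le> t0")
    case True
    thus ?thesis using V_mono[of t t0] t0 by simp
  next
    case False
    thus ?thesis using strict[of t0 t] assms t0 by simp
  qed
  hence "{t. V t \<le> v} = {..t0}" by auto
  thus ?thesis using t0 by (simp add: cdf_def)
qed

lemma V_measurable [measurable]: "V \<in> borel_measurable borel"
  using cont by (intro borel_measurable_continuous_onI continuous_at_imp_continuous_on) auto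

lemma AE_in_T: "AE t in \<nu>. t \<in> T"
proof -
  have "measure \<nu> {t. V t \<le> 0} \<le> v" if "0 < v" "v < 1" for v
  proof -
    have "{t. V t \<le> 0} \<subseteq> {t. V t \<le> v}" using that by auto
    hence "measure \<nu> {t. V t \<le> 0} \<le> measure \<nu> {t. V t \<le> v}"
      by (rule source.finite_measure_mono) simp
    thus ?thesis using measure_V_le[OF that] by simp
  qed
  hence "measure \<nu> {t. V t \<le> 0} \<le> 0"
    by (intro dense_ge_bounded[of 0 1]) auto
  hence 1: "AE t in \<nu>. \<not> V t \<le> 0"
    by (subst AE_iff_measurable[OF _ refl]) (auto simp: source.emeasure_eq_measure measure_le_0_iff)
  have "measure \<nu> {t. 1 \<le> V t} \<le> 1 - v" if "0 < v" "v < 1" for v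
  proof -
    have "measure \<nu> {t. 1 \<le> V t} \<le> measure \<nu> (UNIV - {t. V t \<le> v})"
      using that by (intro source.finite_measure_mono) auto
    also have "\<dots> = 1 - v"
      using source.prob_compl[of "{t. V t \<le> v}"] measure_V_le[OF that] by simp
    finally show ?thesis .
  qed
  hence "v \<le> 1 - measure \<nu> {t. 1 \<le> V t}" if "0 < v" "v < 1" for v
    using that by force
  hence "1 \<le> 1 - measure \<nu> {t. 1 \<le> V t}"
    by (intro dense_le_bounded[of 0 1]) auto
  moreover have "{t. 1 \<le> V t} \<in> sets borel" by measurable
  ultimately have 2: "AE t in \<nu>. \<not> 1 \<le> V t"
    by (subst AE_iff_measurable[OF _ refl]) (auto simp: source.emeasure_eq_measure measure_le_0_iff)
  from 1 2 show ?thesis by eventually_elim (simp add: T_def)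
qed

text \<open>\<open>q t \<le> x\<close> is the same as \<open>V t \<le> F x\<close>, an event of probability \<open>F x\<close> because \<open>V\<close> is uniformly
  distributed. What the extension of \<open>q\<close> does outside \<open>T\<close> is invisible to \<open>\<nu>\<close>.\<close>

lemma dominates: "dominates \<nu> \<mu>"
proof -
  obtain h where h: "1-lipschitz_on UNIV h" "\<And>t. t \<in> T \<Longrightarrow> h t = q t"
    using lipschitz_extension[OF q_lipschitz] by blast
  have hm [measurable]: "h \<in> borel_measurable borel"
    using h(1) by (intro borel_measurable_continuous_onI lipschitz_on_continuous_on)
  interpret distr: real_distribution "distr \<nu> borel h" by (rule source.real_distribution_distr) simp
  have "cdf (distr \<nu> borel h) x = F x" for x
  proof -
    have "cdf (distr \<nu> borel h) x = measure \<nu> {t. h t \<le> x}"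
      by (simp add: cdf_def measure_distr vimage_def)
    also have "\<dots> = measure \<nu> {t. V t \<le> F x}"
    proof (rule source.finite_measure_eq_AE)
      show "AE t in \<nu>. t \<in> {t. h t \<le> x} \<longleftrightarrow> t \<in> {t. V t \<le> F x}"
        using AE_in_T by eventually_elim (simp add: h(2) q_le_iff)
    qed measurable
    also have "\<dots> = F x"
    proof -
      consider "F x = 0" | "F x = 1" | "0 < F x" "F x < 1"
        using target.cdf_nonneg[of x] target.cdf_bounded_prob[of x] by linarith
      thus ?thesis
      proof cases
        case 1
        have "measure \<nu> {t. V t \<le> 0} = measure \<nu> {}"
          using AE_in_T by (intro source.finite_measure_eq_AE) (auto simp: T_def elim!: eventually_mono)
        thus ?thesis using 1 by simp
      next
        case 2
        thus ?thesis using source.cdf_bounded_prob source.prob_space by simp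
      qed (rule measure_V_le)
    qed
    finally show ?thesis .
  qed
  hence "distr \<nu> borel h = \<mu>"
    by (intro cdf_unique) (auto intro: distr.real_distribution_axioms target.real_distribution_axioms)
  thus ?thesis using h(1) source.real_distribution_axioms target.real_distribution_axioms
    by (auto simp: dominates_def)
qed

end

section \<open>Absolutely continuous measures with connected support\<close>

text \<open>The complement of the support is a union of open null sets, of which countably many suffice
  in a second countable space.\<close>

lemma in_measure_support:
  fixes M :: "'a::second_countable_topology measure"
  assumes "sets M = sets borel" "A \<in> sets borel" "0 < emeasure M A"
  obtains x where "x \<in> A" "x \<in> measure_support M"
proof (rule ccontr)
  assume *: "\<not> thesis"
  define \<U> where "\<U> = {U. open U \<and> emeasure M U = 0}"
  obtain \<U>' where U': "\<U>' \<subseteq> \<U>" "countable \<U>'" "\<Union>\<U>' = \<Union>\<U>"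
    using Lindelof[of \<U>] by (auto simp: \<U>_def)
  have "\<Union>\<U>' \<in> null_sets M"
  proof -
    have null: "U \<in> null_sets M" if "U \<in> \<U>'" for U
      using U'(1) that assms(1) by (auto simp: \<U>_def null_sets_def)
    from null_sets_UN'[of \<U>' "\<lambda>U. U" M, OF U'(2) null] show ?thesis by simp
  qed
  moreover have "A \<subseteq> \<Union>\<U>'"
    using * that unfolding U'(3) \<U>_def measure_support_def by (auto, metis not_gr_zero)
  ultimately have "A \<in> null_sets M" using assms by (metis null_sets_subset)
  thus False using assms(3) by auto
qed

text \<open>Neither \<open>{..s}\<close> nor \<open>{t<..}\<close> is null if \<open>cdf \<nu>\<close> has the same value at \<open>s\<close> and \<open>t\<close>, so both
  contain points of the support, and by connectedness so does the interval between them.\<close>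

lemma cdf_strict_if_connected_support:
  assumes "real_distribution \<nu>" "connected (measure_support \<nu>)"
    and "s < t" "0 < cdf \<nu> s" "cdf \<nu> s < 1"
  shows "cdf \<nu> s < cdf \<nu> t"
proof (rule ccontr)
  interpret real_distribution \<nu> by fact
  assume "\<not> cdf \<nu> s < cdf \<nu> t"
  hence eq: "cdf \<nu> t = cdf \<nu> s" using cdf_nondecreasing[of s t] assms(3) by simp
  obtain x where x: "x \<le> s" "x \<in> measure_support \<nu>"
    using in_measure_support[of \<nu> "{..s}"] assms(4) by (auto simp: cdf_def emeasure_eq_measure)
  have "measure \<nu> {t<..} = 1 - cdf \<nu> t"
    using prob_compl[of "{..t}"] by (simp add: cdf_def Compl_eq_Diff_UNIV[symmetric])
  then obtain y where y: "t < y" "y \<in> measure_support \<nu>"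
    using in_measure_support[of \<nu> "{t<..}"] assms(5) eq by (auto simp: emeasure_eq_measure)
  have "(s + t) / 2 \<in> measure_support \<nu>"
    using connectedD_interval[OF assms(2) x(2) y(2), of "(s + t) / 2"] x(1) y(1) assms(3) by simp
  moreover have "(s + t) / 2 \<in> {s<..<t}" using assms(3) by simp
  ultimately have "0 < emeasure \<nu> {s<..<t}"
    unfolding measure_support_def using open_greaterThanLessThan by blast
  moreover have "measure \<nu> {s<..<t} \<le> measure \<nu> {s<..t}" by (intro finite_measure_mono) auto
  ultimately show False using cdf_diff_eq[OF assms(3)] eq by (simp add: emeasure_eq_measure)
qed

lemma isCont_cdf_if_absolutely_continuous:
  assumes "real_distribution \<nu>" "absolutely_continuous lborel \<nu>"
  shows "isCont (cdf \<nu>) t"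
proof -
  interpret real_distribution \<nu> by fact
  have "{t} \<in> null_sets lborel" by (simp add: null_sets_def)
  hence "{t} \<in> null_sets \<nu>" using assms(2) unfolding absolutely_continuous_def by blast
  thus ?thesis by (simp add: isCont_cdf measure_def null_setsD1)
qed

section \<open>Observables of a space with an isoperimetric comparison\<close>

lemma boundary_measure_sublevel_le:
  fixes M :: "'a::metric_space measure" and f :: "'a \<Rightarrow> real"
  assumes "prob_space M" "sets M = sets borel" and f: "1-lipschitz_on UNIV f"
  shows "boundary_measure M {x. f x \<le> s} \<le> upper_right_derivative (cdf (distr M borel f)) s"
proof -
  interpret prob_space M by fact
  have [measurable]: "f \<in> borel_measurable M"
    using lipschitz_on_continuous_on[OF f] borel_measurable_continuous_onI assms(2)
    by (metis measurable_cong_sets)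
  have sp: "space M = UNIV" using sets_eq_imp_space_eq[OF assms(2)] by simp
  have cdf: "cdf (distr M borel f) x = measure M {y. f y \<le> x}" for x
    by (simp add: cdf_def measure_distr vimage_def sp)
  have nbhd: "open_nbhd \<epsilon> {x. f x \<le> s} \<subseteq> {x. f x \<le> s + \<epsilon>}" for \<epsilon>
  proof
    fix x assume "x \<in> open_nbhd \<epsilon> {x. f x \<le> s}"
    then obtain y where "f y \<le> s" "dist y x < \<epsilon>" by (auto simp: open_nbhd_def)
    thus "x \<in> {x. f x \<le> s + \<epsilon>}" using lipschitz_onD[OF f, of y x] by (auto simp: dist_real_def)
  qed
  have meas: "{x. f x \<le> r} \<in> sets M" for r
    using measurable_sets[of f M borel "{..r}"] by (simp add: vimage_def sp)
  show ?thesis unfolding boundary_measure_def upper_right_derivative_def cdf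
  proof (intro Limsup_mono eventually_at_rightI[of 0 1])
    fix \<epsilon> :: real assume "\<epsilon> \<in> {0<..<1}"
    thus "ereal ((measure M (open_nbhd \<epsilon> {x. f x \<le> s}) - measure M {x. f x \<le> s}) / \<epsilon>)
       \<le> ereal ((measure M {y. f y \<le> s + \<epsilon>} - measure M {y. f y \<le> s}) / \<epsilon>)"
      using finite_measure_mono[OF nbhd[of \<epsilon>] meas] by (auto intro!: divide_right_mono)
  qed simp
qed

text \<open>All sets compared here are sublevel sets of \<open>f\<close>. They are closed, hence subject to essential
  connectedness, and the measure of \<open>{f \<le> s}\<close> is the value of the distribution function of \<open>f\<close>
  at \<open>s\<close>, so that the isoperimetric comparison applies at almost all \<open>t\<close> with this value of
  \<open>cdf \<nu> t\<close>.\<close>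

lemma dominates_observable:
  fixes M :: "'a::metric_space measure" and f :: "'a \<Rightarrow> real"
  assumes M: "prob_space M" "sets M = sets borel" "essentially_connected M"
    and \<nu>: "real_distribution \<nu>" "absolutely_continuous lborel \<nu>" "connected (measure_support \<nu>)"
    and IC: "satisfies_IC M \<nu>" and f: "1-lipschitz_on UNIV f"
  shows "dominates \<nu> (distr M borel f)"
proof -
  interpret M: prob_space M by fact
  interpret \<nu>: real_distribution \<nu> by fact
  have contf: "continuous_on UNIV f" by (rule lipschitz_on_continuous_on[OF f])
  have fm [measurable]: "f \<in> borel_measurable M"
    using borel_measurable_continuous_onI[OF contf] M(2) by (metis measurable_cong_sets)
  let ?F = "cdf (distr M borel f)" and ?A = "\<lambda>s. {x. f x \<le> s}"
  have sp: "space M = UNIV" using sets_eq_imp_space_eq[OF M(2)] by simp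
  have F: "?F s = measure M (?A s)" for s
    by (simp add: cdf_def measure_distr vimage_def sp)
  have closed: "closed (?A s)" for s
    by (rule closed_Collect_le[OF contf]) simp
  note perimeter = boundary_measure_sublevel_le[OF M(1,2) f]
  have "quantile_transport \<nu> (distr M borel f)"
  proof (intro quantile_transport.intro quantile_transport_axioms.intro cdf_distribution.intro)
    show "real_distribution \<nu>" "real_distribution (distr M borel f)"
      using \<nu>(1) fm by auto
  next
    fix t show "isCont (cdf \<nu>) t" by (rule isCont_cdf_if_absolutely_continuous[OF \<nu>(1,2)])
  next
    fix s t :: real assume "s < t" "0 < cdf \<nu> s" "cdf \<nu> s < 1"
    thus "cdf \<nu> s < cdf \<nu> t" by (rule cdf_strict_if_connected_support[OF \<nu>(1,3)])
  next
    fix s assume "0 < ?F s" "?F s < 1"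
    hence "0 < boundary_measure M (?A s)"
      using M(3) closed unfolding essentially_connected_def F by blast
    thus "0 < upper_right_derivative ?F s" using perimeter by (rule less_le_trans)
  next
    have "AE t in \<nu>. cdf \<nu> t \<in> measure_values M \<longrightarrow>
        (\<exists>D. (cdf \<nu> has_real_derivative D) (at t) \<and> isoperimetric_profile M (cdf \<nu> t) \<ge> ereal D)"
      using IC unfolding satisfies_IC_def
      by (rule absolutely_continuous_AE[OF _ \<nu>(2), rotated]) simp
    thus "AE t in \<nu>. \<forall>s. 0 < cdf \<nu> t \<longrightarrow> cdf \<nu> t < 1 \<longrightarrow> ?F s = cdf \<nu> t \<longrightarrow>
        (\<exists>D. (cdf \<nu> has_real_derivative D) (at t) \<and> ereal D \<le> upper_right_derivative ?F s)"
    proof eventually_elim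
      case (elim t)
      show ?case
      proof (intro allI impI)
        fix s assume eq: "?F s = cdf \<nu> t"
        have A: "?A s \<in> sets borel" "measure M (?A s) = cdf \<nu> t"
          using closed eq by (auto simp: F)
        hence "cdf \<nu> t \<in> measure_values M" unfolding measure_values_def
          by (intro CollectI exI[of _ "?A s"]) simp
        with elim obtain D where D: "(cdf \<nu> has_real_derivative D) (at t)"
          "ereal D \<le> isoperimetric_profile M (cdf \<nu> t)" by blast
        note D(2)
        also have "isoperimetric_profile M (cdf \<nu> t) \<le> boundary_measure M (?A s)"
          unfolding isoperimetric_profile_def using A by (intro Inf_lower) auto
        also note perimeter
        finally show "\<exists>D. (cdf \<nu> has_real_derivative D) (at t) \<and> ereal D \<le> upper_right_derivative ?F s"
          using D(1) by blast
      qed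
    qed
  qed
  thus ?thesis by (rule quantile_transport.dominates)
qed

section \<open>Domination and the observable variance\<close>

lemma Var_lam_distr:
  assumes "prob_space M" and g [measurable]: "g \<in> borel_measurable M"
    and \<Lambda>: "continuous_on {0..} \<Lambda>"
  shows "Var_lam \<Lambda> (distr M borel g) = (\<integral>\<^sup>+x'. (\<integral>\<^sup>+x. ennreal (\<Lambda> \<bar>g x - g x'\<bar>) \<partial>M) \<partial>M)"
proof -
  interpret prob_space M by fact
  interpret distr: prob_space "distr M borel g" by (rule prob_space_distr) simp
  have "continuous_on UNIV (\<lambda>p::real \<times> real. \<Lambda> \<bar>fst p - snd p\<bar>)"
    by (intro continuous_on_compose2[OF \<Lambda>] continuous_intros) auto
  hence [measurable]: "(\<lambda>p::real \<times> real. \<Lambda> \<bar>fst p - snd p\<bar>) \<in> borel_measurable (borel \<Otimes>\<^sub>M borel)"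
    unfolding borel_prod by (rule borel_measurable_continuous_onI)
  have [measurable]: "(\<lambda>x. \<Lambda> \<bar>x - x'\<bar>) \<in> borel_measurable borel" for x' :: real
    by (intro borel_measurable_continuous_onI continuous_on_compose2[OF \<Lambda>] continuous_intros) auto
  have "(\<lambda>(x'::real, x). ennreal (\<Lambda> \<bar>x - x'\<bar>)) \<in> borel_measurable (borel \<Otimes>\<^sub>M distr M borel g)"
    using \<open>(\<lambda>p::real \<times> real. \<Lambda> \<bar>fst p - snd p\<bar>) \<in> borel_measurable (borel \<Otimes>\<^sub>M borel)\<close>
    by (subst measurable_cong_sets[OF sets_pair_measure_cong[OF refl sets_distr] refl])
       (simp add: case_prod_beta abs_minus_commute)
  from distr.borel_measurable_nn_integral[OF this]
  have meas: "(\<lambda>x'. \<integral>\<^sup>+x. ennreal (\<Lambda> \<bar>x - x'\<bar>) \<partial>distr M borel g) \<in> borel_measurable (distr M borel g)"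
    by simp
  show ?thesis unfolding Var_lam_def
    by (subst nn_integral_distr[OF g meas]) (simp add: nn_integral_distr)
qed

lemma Var_lam_le_if_dominates:
  assumes mono: "mono_on {0..} \<Lambda>" and cont: "continuous_on {0..} \<Lambda>" and dom: "dominates \<nu> \<mu>"
  shows "Var_lam \<Lambda> \<mu> \<le> Var_lam \<Lambda> \<nu>"
proof -
  from dom obtain h where h: "1-lipschitz_on UNIV h" "\<mu> = distr \<nu> borel h"
    and \<nu>: "real_distribution \<nu>" by (auto simp: dominates_def)
  interpret real_distribution \<nu> by fact
  have [measurable]: "h \<in> borel_measurable \<nu>"
    using h(1) by (intro measurable_finite_borel borel_measurable_continuous_onI lipschitz_on_continuous_on)
  have "\<Lambda> \<bar>h x - h x'\<bar> \<le> \<Lambda> \<bar>x - x'\<bar>" for x x'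
    using lipschitz_onD[OF h(1), of x x'] by (intro mono_onD[OF mono]) (auto simp: dist_real_def)
  thus ?thesis unfolding h(2)
    by (subst Var_lam_distr[OF prob_space_axioms _ cont])
       (auto simp: Var_lam_def intro!: nn_integral_mono ennreal_leI)
qed

lemma ObsVar_le_if_dominant:
  fixes M :: "'a::metric_space measure"
  assumes mono: "mono_on {0..} \<Lambda>" and cont: "continuous_on {0..} \<Lambda>"
    and M: "prob_space M" "sets M = sets borel" and dom: "is_dominant \<nu> M"
  shows "ObsVar \<Lambda> M \<le> Var_lam \<Lambda> \<nu>"
  unfolding ObsVar_def
proof (rule SUP_least)
  fix f :: "'a \<Rightarrow> real" assume "f \<in> {f. 1-lipschitz_on UNIV f}"
  hence f: "1-lipschitz_on UNIV f" by simp
  have fm: "f \<in> borel_measurable M"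
    using borel_measurable_continuous_onI[OF lipschitz_on_continuous_on[OF f]] M(2)
    by (metis measurable_cong_sets)
  have "dominates \<nu> (distr M borel f)" using dom f by (simp add: is_dominant_def)
  from Var_lam_le_if_dominates[OF mono cont this]
  show "(\<integral>\<^sup>+x'. (\<integral>\<^sup>+x. ennreal (\<Lambda> \<bar>f x - f x'\<bar>) \<partial>M) \<partial>M) \<le> Var_lam \<Lambda> \<nu>"
    by (simp add: Var_lam_distr[OF M(1) fm cont])
qed

theorem theorem1p8:
  fixes \<Lambda> :: "real \<Rightarrow> real"
    and M :: "'a::polish_space measure"
    and \<nu> :: "real measure"
  assumes "\<Lambda> \<in> {0..} \<rightarrow> {0..}"
    and "strict_mono_on {0..} \<Lambda>"
    and "continuous_on {0..} \<Lambda>"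
    and "mm_space M"
    and "geodesic_space TYPE('a)"
    and "essentially_connected M"
    and "\<nu> \<in> Var_class \<Lambda>"
    and "satisfies_IC M \<nu>"
  shows "is_dominant \<nu> M \<and> ObsVar \<Lambda> M \<le> Var_lam \<Lambda> \<nu>"
proof
  have M: "prob_space M" "sets M = sets borel" using assms(4) by (auto simp: mm_space_def)
  have \<nu>: "real_distribution \<nu>" "absolutely_continuous lborel \<nu>" "connected (measure_support \<nu>)"
    using assms(7) by (auto simp: Var_class_def)
  show dom: "is_dominant \<nu> M"
    unfolding is_dominant_def using \<nu>(1) dominates_observable[OF M assms(6) \<nu> assms(8)] by blast
  show "ObsVar \<Lambda> M \<le> Var_lam \<Lambda> \<nu>"
    by (rule ObsVar_le_if_dominant[OF strict_mono_on_imp_mono_on[OF assms(2)] assms(3) M dom])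
qed

end
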